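(* Let $\boldsymbol\theta=(\theta_1,\ldots,\theta_n),\ \boldsymbol\eta=(\eta_1,\ldots,\eta_n)\in\Delta_n$ be such that $\boldsymbol\theta\prec_{\rm m}\boldsymbol\eta$, and denote $b=1/\eta_{(1)}$, where $\eta_{(1)}=\min\{\eta_1,\ldots,\eta_n\}>0$. Let $X_1,\ldots,X_n$ be independent and identically distributed with a common distribution function $F\in\mathcal{H}$, and define $(Y_1,\ldots,Y_n)=(X_1\wedge c,\ldots,X_n\wedge c)$ with $c\in(b,\infty)$. Then $$\mathbb{P}\left(\sum_{i=1}^n\eta_iY_i>x\right)\ \le\ \mathbb{P}\left(\sum_{i=1}^n\theta_iY_i>x\right),\quad x\in\left[0,\frac{c}{b}\right).$$
   Context: $\mathbb{R}_{++}=(0,\infty)$, $\Delta_n=\left\{\boldsymbol\theta\in(0,1)^n:\sum_{i=1}^n\theta_i=1\right\}$, and $a\wedge c=\min\{a,c\}$. For a distribution function $F$, $\overline F=1-F$. The class $\mathcal{H}$ consists of the non-degenerate distribution functions $F$ (not that of a constant) with $F(0-)=0$ such that $x\mapsto\overline F(1/x)$ is concave on $\mathbb{R}_{++}$. Majorization: for $\mathbf{a},\mathbf{b}\in\mathbb{R}^n$ with increasing rearrangements $a_{(1)}\le\cdots\le a_{(n)}$, $b_{(1)}\le\cdots\le b_{(n)}$, $\mathbf{a}\preceq_{\rm m}\mathbf{b}$ means $\sum_{i=1}^n a_{(i)}=\sum_{i=1}^n b_{(i)}$ and $\sum_{i=1}^j a_{(i)}\ge\sum_{i=1}^j b_{(i)}$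 for $j=1,\ldots,n-1$; $\mathbf{a}\prec_{\rm m}\mathbf{b}$ means in addition that at least one of these inequalities is strict. *)

theory Defs
  imports "HOL-Probability.Probability"
begin

text \<open>
  A vector in \<open>\<real>\<^sup>n\<close> is a function \<open>nat \<Rightarrow> real\<close> of which only the values at \<open>0, \<dots>, n - 1\<close> matter;
  components are indexed from \<open>0\<close>.
\<close>

definition open_simplex :: "nat \<Rightarrow> (nat \<Rightarrow> real) set" where
  "open_simplex n = {\<theta>. (\<forall>i<n. \<theta> i \<in> {0<..<1}) \<and> (\<Sum>i<n. \<theta> i) = 1}"

text \<open>\<open>incr_rearr n a i\<close> is the order statistic \<open>a\<^bsub>(i+1)\<^esub>\<close>; it is only meaningful for \<open>i < n\<close>.\<close>

definition incr_rearr :: "nat \<Rightarrow> (nat \<Rightarrow> real) \<Rightarrow> nat \<Rightarrow> real" where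
  "incr_rearr n a i = sort (map a [0..<n]) ! i"

definition majorized :: "nat \<Rightarrow> (nat \<Rightarrow> real) \<Rightarrow> (nat \<Rightarrow> real) \<Rightarrow> bool" where
  "majorized n a b \<longleftrightarrow>
     (\<Sum>i<n. incr_rearr n a i) = (\<Sum>i<n. incr_rearr n b i) \<and>
     (\<forall>j\<in>{1..<n}. (\<Sum>i<j. incr_rearr n a i) \<ge> (\<Sum>i<j. incr_rearr n b i))"

definition strictly_majorized :: "nat \<Rightarrow> (nat \<Rightarrow> real) \<Rightarrow> (nat \<Rightarrow> real) \<Rightarrow> bool" where
  "strictly_majorized n a b \<longleftrightarrow>
     majorized n a b \<and>
     (\<exists>j\<in>{1..<n}. (\<Sum>i<j. incr_rearr n a i) > (\<Sum>i<j. incr_rearr n b i))"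

definition distribution_function :: "(real \<Rightarrow> real) \<Rightarrow> bool" where
  "distribution_function F \<longleftrightarrow> (\<exists>\<mu>. real_distribution \<mu> \<and> F = cdf \<mu>)"

text \<open>
  The second conjunct is non-degeneracy: \<open>indicator {a..}\<close> is the distribution function of the
  constant \<open>a\<close>. The third one is \<open>F(0-) = 0\<close>, so an atom at \<open>0\<close> is allowed.
\<close>

definition class_H :: "(real \<Rightarrow> real) set" where
  "class_H = {F. distribution_function F \<and>
                 (\<nexists>a. F = indicator {a..}) \<and>
                 (F \<longlongrightarrow> 0) (at_left 0) \<and>
                 concave_on {0<..} (\<lambda>x. 1 - F (1 / x))}"

end

theory Submission
  imports Defs "HOL-Combinatorics.Permutations"
begin

text \<open>
  Truncation at \<open>c\<close> is invisible at levels below \<open>c / b\<close>: all weights are at least \<open>1 / b\<close>, so a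
  weighted sum that contains one truncated variable already exceeds such a level. It therefore suffices
  to show that \<open>P(\<Sum> r\<^sub>k X\<^sub>k \<le> x)\<close> is Schur-convex in the positive weights \<open>r\<close>, for the variables
  themselves (\<open>cdf_weighted_sum_Schur\<close>).

  Majorization is generated by transfers that change two weights and keep their sum
  (\<open>Schur_criterion\<close>). Conditioning on the other variables leaves the comparison of
  \<open>P(a X + b X' \<le> x)\<close> for different \<open>(a, b)\<close> with the same sum, where by scaling \<open>x = 1\<close>.

  Concavity of the tail at \<open>1 / t\<close> says that \<open>1 / X\<close> has a decreasing density on \<open>(0, \<infinity>)\<close>, besides
  an atom at infinity from \<open>X = 0\<close>. A decreasing density is a mixture of uniform densities on intervals
  \<open>(0, k)\<close> (\<open>Pareto_mixture\<close>). In the coordinates \<open>u = 1 / X\<close>, \<open>v = 1 / X'\<close> the event \<open>a X + b X' \<le> 1\<close>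
  is the region \<open>(u - a) (v - b) \<ge> a b\<close> above a branch of a hyperbola. So, apart from the atom, its
  probability is a mixture of the areas that this region cuts out of rectangles \<open>(0, k) \<times> (0, l)\<close>, and
  such an area is \<open>a b \<psi>(D / (a b))\<close> with \<open>D = k l - k b - l a\<close> and the convex function
  \<open>\<psi>(t) = t - ln (1 + t)\<close> for \<open>t \<ge> 0\<close>, \<open>\<psi>(t) = 0\<close> for \<open>t < 0\<close> (\<open>nn_integral_hyperbola\<close>). As the two
  variables have the same law, the areas for \<open>(k, l)\<close> and \<open>(l, k)\<close> may be added, and convexity of \<open>\<psi>\<close>
  shows that this sum grows when \<open>a\<close> and \<open>b\<close> move apart (\<open>hyperbola_area_spread\<close>).
\<close>

section \<open>Majorization and transfers\<close>

text \<open>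
  The transfer argument of Hardy, Littlewood and Polya. Any \<open>q\<close> whose
  partial sums lie below those of a sorted \<open>p\<close> can be moved to \<open>p\<close> by steps that bring two of its entries closer
  together. Leaving \<open>q\<close> unsorted matters, because a step may destroy the order of its entries.
\<close>

lemma Schur_criterion_sorted:
  fixes \<Phi> :: "(nat \<Rightarrow> real) \<Rightarrow> 'b::preorder"
  assumes cong: "\<And>p q. (\<And>k. k < n \<Longrightarrow> p k = q k) \<Longrightarrow> \<Phi> p = \<Phi> q"
    and transfer: "\<And>q i j s t. \<lbrakk>i < n; j < n; i \<noteq> j; 0 < q i; 0 < q j; s + t = q i + q j;
        min (q i) (q j) \<le> s; min (q i) (q j) \<le> t\<rbrakk> \<Longrightarrow> \<Phi> (q(i := s, j := t)) \<le> \<Phi> q"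
    and pos: "\<And>k. k < n \<Longrightarrow> 0 < q k"
    and mono: "\<And>i j. i \<le> j \<Longrightarrow> j < n \<Longrightarrow> p i \<le> p j"
    and part: "\<And>m. m \<le> n \<Longrightarrow> sum q {..<m} \<le> sum p {..<m}"
    and tot: "sum p {..<n} = sum q {..<n}"
  shows "\<Phi> p \<le> \<Phi> q"
  using pos part tot
proof (induction "card {k. k < n \<and> p k \<noteq> q k}" arbitrary: q rule: less_induct)
  case less
  note pos = less.prems(1) and part = less.prems(2) and tot = less.prems(3)
  show ?case
  proof (cases "\<forall>k<n. p k = q k")
    case True
    then have "\<Phi> p = \<Phi> q" by (intro cong) auto
    then show ?thesis by simp
  next
    case False
    have ex: "\<exists>j. j < n \<and> p j < q j"
    proof (rule ccontr)
      assume *: "\<not> ?thesis"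
      then have le: "\<And>k. k < n \<Longrightarrow> q k \<le> p k" by (meson not_le)
      obtain k where "k < n" "q k < p k" using False le by (metis less_le)
      then have "sum q {..<n} < sum p {..<n}"
        using le by (intro sum_strict_mono_ex1) auto
      with tot show False by simp
    qed
    \<comment> \<open>The transfer goes from the first deficient index \<open>j\<close> to the last index \<open>i\<close> before it with a surplus,
      so that \<open>p\<close> and \<open>q\<close> agree in between.\<close>
    define j where "j = (LEAST j. j < n \<and> p j < q j)"
    have j: "j < n" "p j < q j" using LeastI_ex[OF ex] by (auto simp: j_def)
    have jl: "q k \<le> p k" if "k < j" for k
      using not_less_Least[of k "\<lambda>j. j < n \<and> p j < q j"] that j by (auto simp: j_def)
    have exi: "\<exists>i<j. q i < p i"
    proof (rule ccontr)
      assume "\<not> ?thesis"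
      then have "sum p {..<j} \<le> sum q {..<j}" by (intro sum_mono) (metis lessThan_iff not_less)
      then show False using part[of "Suc j"] j by simp
    qed
    define i where "i = Max {i. i < j \<and> q i < p i}"
    have fin: "finite {i. i < j \<and> q i < p i}" by simp
    have i: "i < j" "q i < p i"
      using Max_in[OF fin] exi by (auto simp: i_def)
    have between: "p k = q k" if "i < k" "k < j" for k
    proof -
      have "\<not> q k < p k" using Max_ge[OF fin, of k] that by (auto simp: i_def[symmetric])
      then show ?thesis using jl[of k] that by simp
    qed
    have pij: "p i \<le> p j" using mono i j by simp
    \<comment> \<open>The largest amount that overshoots neither entry; it settles at least one of them.\<close>
    define \<delta> where "\<delta> = min (p i - q i) (q j - p j)"
    have \<delta>: "\<delta> > 0" "\<delta> \<le> p i - q i" "\<delta> \<le> q j - p j"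
      using i j by (auto simp: \<delta>_def)
    define q' where "q' = q(i := q i + \<delta>, j := q j - \<delta>)"
    have step: "\<Phi> q' \<le> \<Phi> q"
      unfolding q'_def using i j \<delta> pij pos[of i] pos[of j] by (intro transfer) auto
    have q': "sum q' {..<m} = sum q {..<m} + (if i < m then \<delta> else 0) - (if j < m then \<delta> else 0)" for m
    proof -
      have "sum q' {..<m} = (\<Sum>k<m. q k + (if k = i then \<delta> else 0) - (if k = j then \<delta> else 0))"
        using i by (intro sum.cong) (auto simp: q'_def)
      then show ?thesis by (simp add: sum.distrib sum_subtractf)
    qed
    have "\<Phi> p \<le> \<Phi> q'"
    proof (rule less.hyps)
      have "{k. k < n \<and> p k \<noteq> q' k} \<subseteq> {k. k < n \<and> p k \<noteq> q k}"
        using i j by (auto simp: q'_def)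
      moreover have "\<exists>k\<in>{i, j}. p k = q' k"
        using i by (auto simp: q'_def \<delta>_def min_def)
      then have "{k. k < n \<and> p k \<noteq> q' k} \<noteq> {k. k < n \<and> p k \<noteq> q k}"
        using i j by fastforce
      ultimately show "card {k. k < n \<and> p k \<noteq> q' k} < card {k. k < n \<and> p k \<noteq> q k}"
        by (intro psubset_card_mono) auto
      show "0 < q' k" if "k < n" for k
        using pos[OF that] pos[of i] pij i j \<delta> by (auto simp: q'_def)
      \<comment> \<open>Only the partial sums that contain \<open>i\<close> but not \<open>j\<close> increase; for these the surplus
        \<open>p i - q i\<close> leaves enough room.\<close>
      show "sum q' {..<m} \<le> sum p {..<m}" if m: "m \<le> n" for m
      proof (cases "i < m \<and> m \<le> j")
        case True
        have split: "{..<m} = {..<i} \<union> {i} \<union> {i<..<m}" using True by auto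
        have "sum f {..<m} = sum f {..<i} + f i + sum f {i<..<m}" for f :: "nat \<Rightarrow> real"
          unfolding split by (subst sum.union_disjoint, auto)+
        moreover have "sum p {i<..<m} = sum q {i<..<m}"
          using between True by (intro sum.cong) auto
        ultimately have "sum p {..<m} - sum q {..<m} = (sum p {..<i} - sum q {..<i}) + (p i - q i)"
          by simp
        then show ?thesis using part[of i] i j True \<delta> by (simp add: q')
      qed (use part[OF m] i in \<open>auto simp: q'\<close>)
      show "sum p {..<n} = sum q' {..<n}" using tot i j by (simp add: q')
    qed
    with step show ?thesis by (rule order_trans[rotated])
  qed
qed

text \<open>
  Exchanging two entries is an extreme transfer, so a functional that is monotone under transfers is
  invariant under permutations. This allows passing between a vector and its rearrangement.
\<close>

lemma transfer_imp_permutation: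
  fixes \<Phi> :: "(nat \<Rightarrow> real) \<Rightarrow> 'b::preorder"
  assumes transfer: "\<And>q i j s t. \<lbrakk>i < n; j < n; i \<noteq> j; 0 < q i; 0 < q j; s + t = q i + q j;
        min (q i) (q j) \<le> s; min (q i) (q j) \<le> t\<rbrakk> \<Longrightarrow> \<Phi> (q(i := s, j := t)) \<le> \<Phi> q"
    and pos: "\<And>k. k < n \<Longrightarrow> 0 < q k"
    and \<pi>: "\<pi> permutes {..<n}"
  shows "\<Phi> (q \<circ> \<pi>) \<le> \<Phi> q"
  using finite_lessThan[of n] \<pi> pos
proof (induction arbitrary: q rule: permutes_rev_induct)
  case id
  then show ?case by simp
next
  case (swap a b \<pi>)
  let ?r = "q \<circ> \<pi>"
  have pr: "0 < ?r k" if "k < n" for k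
    using swap.prems permutes_in_image[OF swap.hyps(4), of k] that by simp
  have "\<Phi> (?r \<circ> Transposition.transpose a b) \<le> \<Phi> ?r"
  proof (cases "a = b")
    case False
    have "?r \<circ> Transposition.transpose a b = ?r(a := ?r b, b := ?r a)"
      using False by (auto simp: fun_eq_iff Transposition.transpose_def)
    then show ?thesis using False swap.hyps pr by (simp only:) (intro transfer, auto)
  qed simp
  also have "\<Phi> ?r \<le> \<Phi> q" using swap by blast
  finally show ?case by (simp only: comp_assoc)
qed

lemma Schur_criterion:
  fixes \<Phi> :: "(nat \<Rightarrow> real) \<Rightarrow> 'b::preorder"
  assumes cong: "\<And>p q. (\<And>k. k < n \<Longrightarrow> p k = q k) \<Longrightarrow> \<Phi> p = \<Phi> q"
    and transfer: "\<And>q i j s t. \<lbrakk>i < n; j < n; i \<noteq> j; 0 < q i; 0 < q j; s + t = q i + q j;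
        min (q i) (q j) \<le> s; min (q i) (q j) \<le> t\<rbrakk> \<Longrightarrow> \<Phi> (q(i := s, j := t)) \<le> \<Phi> q"
    and pos: "\<And>k. k < n \<Longrightarrow> 0 < p k" "\<And>k. k < n \<Longrightarrow> 0 < q k"
    and maj: "majorized n p q"
  shows "\<Phi> p \<le> \<Phi> q"
proof -
  let ?p = "incr_rearr n p" and ?q = "incr_rearr n q"
  have sort_pos: "0 < incr_rearr n r k" if "\<And>k. k < n \<Longrightarrow> 0 < r k" "k < n" for r k
  proof -
    have "incr_rearr n r k \<in> set (sort (map r [0..<n]))"
      unfolding incr_rearr_def using that by (intro nth_mem) simp
    then show ?thesis using that by auto
  qed
  obtain \<pi> where \<pi>: "\<pi> permutes {..<length (sort (map p [0..<n]))}"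
    "permute_list \<pi> (sort (map p [0..<n])) = map p [0..<n]"
    by (rule mset_eq_permutation[of "map p [0..<n]" "sort (map p [0..<n])"]) simp
  obtain \<sigma> where \<sigma>: "\<sigma> permutes {..<length (map q [0..<n])}"
    "permute_list \<sigma> (map q [0..<n]) = sort (map q [0..<n])"
    by (rule mset_eq_permutation[of "sort (map q [0..<n])" "map q [0..<n]"]) simp
  have "p k = (?p \<circ> \<pi>) k" if "k < n" for k
    using arg_cong[OF \<pi>(2), of "\<lambda>xs. xs ! k"] that \<pi>(1)
    by (simp add: permute_list_nth incr_rearr_def)
  then have "\<Phi> p = \<Phi> (?p \<circ> \<pi>)" by (intro cong) auto
  also have "\<dots> \<le> \<Phi> ?p"
    using \<pi> by (intro transfer_imp_permutation[where \<Phi> = \<Phi> and n = n, OF transfer] sort_pos pos) auto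
  also have "\<Phi> ?p \<le> \<Phi> ?q"
  proof (rule Schur_criterion_sorted[where \<Phi> = \<Phi> and n = n, OF cong transfer])
    show "?p i \<le> ?p j" if "i \<le> j" "j < n" for i j
      unfolding incr_rearr_def using that by (intro sorted_nth_mono) auto
    show "sum ?q {..<m} \<le> sum ?p {..<m}" if "m \<le> n" for m
      using maj that unfolding majorized_def
      by (cases "m = 0"; cases "m = n") auto
  qed (use maj sort_pos pos in \<open>auto simp: majorized_def\<close>)
  also have "\<Phi> ?q = \<Phi> (q \<circ> \<sigma>)"
  proof (rule cong)
    fix k assume "k < n"
    moreover have "\<sigma> k < n" using permutes_in_image[of \<sigma> "{..<n}" k] \<sigma>(1) \<open>k < n\<close> by simp
    ultimately show "?q k = (q \<circ> \<sigma>) k"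
      using arg_cong[OF \<sigma>(2), of "\<lambda>xs. xs ! k"] \<sigma>(1)
      by (simp add: permute_list_nth incr_rearr_def)
  qed
  also have "\<dots> \<le> \<Phi> q"
    using \<sigma> pos by (intro transfer_imp_permutation[where \<Phi> = \<Phi> and n = n, OF transfer]) auto
  finally show ?thesis .
qed

section \<open>Area above a hyperbola\<close>

text \<open>
  The area of the region between the hyperbola \<open>u * v = 1\<close> and the corner of a box
  \<open>[0, p] \<times> [0, q]\<close> with \<open>p * q = 1 + t\<close>; it depends on the product \<open>p * q\<close> only, and for \<open>t \<le> 0\<close>
  there is no such region.
\<close>

definition psi :: "real \<Rightarrow> real" where
  "psi t = max t 0 - ln (1 + max t 0)"

lemma psi_nonpos: "t \<le> 0 \<Longrightarrow> psi t = 0"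
  by (simp add: psi_def max_def)

lemma convex_psi: "convex_on UNIV psi"
proof (rule convex_onI)
  \<comment> \<open>\<open>psi\<close> is a convex function, increasing on \<open>t \<ge> 0\<close>, after the convex map \<open>max t 0\<close>.\<close>
  have conv: "convex_on {-1<..} (\<lambda>t::real. t - ln (1 + t))"
    by (rule convex_on_realI[where f' = "\<lambda>t. 1 - 1 / (1 + t)"])
       (auto intro!: derivative_eq_intros simp: field_simps)
  have mono: "s - ln (1 + s) \<le> t - ln (1 + t)" if "0 \<le> s" "s \<le> t" for s t :: real
  proof -
    have "ln (1 + t) - ln (1 + s) = ln ((1 + t) / (1 + s))" using that by (simp add: ln_div)
    also have "\<dots> \<le> (1 + t) / (1 + s) - 1" using that by (intro ln_le_minus_one) auto
    also have "\<dots> = (t - s) / (1 + s)" using that by (simp add: field_simps)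
    also have "\<dots> \<le> t - s" using that divide_left_mono[of 1 "1 + s" "t - s"] by simp
    finally show ?thesis by simp
  qed
  fix t x y :: real assume t: "0 < t" "t < 1"
  have "max ((1 - t) * x + t * y) 0 \<le> (1 - t) * max x 0 + t * max y 0" (is "_ \<le> ?m")
    using t by (auto intro!: add_mono mult_left_mono add_nonneg_nonneg)
  then have "psi ((1 - t) *\<^sub>R x + t *\<^sub>R y) \<le> ?m - ln (1 + ?m)"
    unfolding psi_def by (simp add: mono)
  also have "\<dots> \<le> (1 - t) * psi x + t * psi y"
    using convex_onD[OF conv, of t "max x 0" "max y 0"] t by (simp add: psi_def)
  finally show "psi ((1 - t) *\<^sub>R x + t *\<^sub>R y) \<le> (1 - t) * psi x + t * psi y" .
qed simp

text \<open>
  The left side is \<open>D\<close> times the slope of the chord of \<open>psi\<close> from \<open>0\<close> to \<open>D / w\<close>, because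
  \<open>psi 0 = 0\<close>; chord slopes of a convex function increase.
\<close>

lemma perspective_psi_antimono:
  assumes "0 < w'" "w' \<le> w"
  shows "w * psi (D / w) \<le> w' * psi (D / w')"
proof -
  have "psi ((1 - w' / w) *\<^sub>R 0 + (w' / w) *\<^sub>R (D / w')) \<le> (1 - w' / w) * psi 0 + (w' / w) * psi (D / w')"
    using assms by (intro convex_onD[OF convex_psi]) (auto simp: divide_le_eq)
  then show ?thesis using assms by (simp add: psi_nonpos field_simps)
qed

text \<open>
  The area of the part of \<open>{0<..<k} \<times> {0<..<l}\<close> where \<open>a / u + b / v \<le> 1\<close>. This is the part above
  the branch \<open>(u - a) * (v - b) = a * b\<close>, and at the corner
  \<open>(k - a) * (l - b) = a * b + (k * l - k * b - l * a)\<close>.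
\<close>

definition hyperbola_area :: "real \<Rightarrow> real \<Rightarrow> real \<Rightarrow> real \<Rightarrow> real" where
  "hyperbola_area a b k l = a * b * psi ((k * l - k * b - l * a) / (a * b))"

lemma hyperbola_area_nonneg:
  assumes "0 < a" "0 < b"
  shows "0 \<le> hyperbola_area a b k l"
proof -
  have "ln (1 + t) \<le> t" if "0 \<le> t" for t :: real using that by (rule ln_add_one_self_le_self)
  then have "0 \<le> psi t" for t by (simp add: psi_def)
  then show ?thesis using assms by (simp add: hyperbola_area_def)
qed

text \<open>
  The inequality behind everything. Let \<open>D\<^sub>1\<close> and \<open>D\<^sub>2\<close> be the expressions
  \<open>k * l - k * b - l * a\<close> for the two orders of \<open>k\<close> and \<open>l\<close>. When \<open>(a, b)\<close> spreads out with \<open>a + b\<close>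
  fixed, \<open>D\<^sub>1 + D\<^sub>2\<close> stays the same while \<open>D\<^sub>1\<close> and \<open>D\<^sub>2\<close> move apart, and \<open>a * b\<close> decreases. Both
  changes increase \<open>a * b * (psi (D\<^sub>1 / (a * b)) + psi (D\<^sub>2 / (a * b)))\<close>, by convexity. A single
  summand need not be monotone: averaging over the two orders is essential.
\<close>

lemma hyperbola_area_spread:
  assumes pos: "0 < a'" "0 < b'" and sum: "a + b = a' + b'"
    and ge: "min a' b' \<le> a" "min a' b' \<le> b"
  shows "hyperbola_area a b k l + hyperbola_area a b l k \<le>
    hyperbola_area a' b' k l + hyperbola_area a' b' l k"
proof -
  obtain r where r: "0 \<le> r" "r \<le> 1" "a = (1 - r) * a' + r * b'" "b = (1 - r) * b' + r * a'"
  proof (cases "a' = b'")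
    case True
    then show ?thesis using sum ge by (intro that[of 0]) auto
  next
    case False
    define r where "r = (a - a') / (b' - a')"
    have "r * (b' - a') = a - a'" using False by (simp add: r_def)
    then have "a = (1 - r) * a' + r * b'" "b = (1 - r) * b' + r * a'"
      using sum by (simp_all add: algebra_simps)
    moreover have "0 \<le> r" "r \<le> 1"
      using False sum ge by (auto simp: r_def zero_le_divide_iff divide_le_eq_1 min_def split: if_splits)
    ultimately show ?thesis using that by blast
  qed
  define w' where "w' = a' * b'"
  define D1 where "D1 = k * l - k * b' - l * a'"
  define D2 where "D2 = l * k - l * b' - k * a'"
  have w': "0 < w'" using pos by (simp add: w'_def)
  have "a * b = w' + r * (1 - r) * (a' - b')\<^sup>2"
    unfolding r w'_def by (simp add: algebra_simps power2_eq_square)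
  then have w: "w' \<le> a * b" using r by simp
  have D: "k * l - k * b - l * a = (1 - r) * D1 + r * D2"
    "l * k - l * b - k * a = (1 - r) * D2 + r * D1"
    unfolding r D1_def D2_def by (simp_all add: algebra_simps)
  have conv: "hyperbola_area a b p q \<le> (1 - r) * (w' * psi (E / w')) + r * (w' * psi (E' / w'))"
    if "p * q - p * b - q * a = (1 - r) * E + r * E'" for p q E E'
  proof -
    have "hyperbola_area a b p q \<le> w' * psi (((1 - r) * E + r * E') / w')"
      unfolding hyperbola_area_def that by (rule perspective_psi_antimono[OF w' w])
    also have "((1 - r) * E + r * E') / w' = (1 - r) *\<^sub>R (E / w') + r *\<^sub>R (E' / w')"
      by (simp add: add_divide_distrib)
    also have "w' * psi \<dots> \<le> w' * ((1 - r) * psi (E / w') + r * psi (E' / w'))"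
      using w' r by (intro mult_left_mono convex_onD[OF convex_psi]) auto
    finally show ?thesis by (simp add: algebra_simps)
  qed
  show ?thesis
    using conv[OF D(1)] conv[OF D(2)]
    by (simp add: hyperbola_area_def D1_def D2_def w'_def algebra_simps)
qed

text \<open>
  For fixed \<open>u\<close> the admissible \<open>v\<close> form an interval that starts at
  \<open>b * u / (u - a) = b + a * b / (u - a)\<close>, so the inner integral is elementary and the outer one has
  the antiderivative \<open>(l - b) * u - a * b * ln (u - a)\<close>.
\<close>

lemma nn_integral_hyperbola:
  assumes pos: "0 < a" "0 < b" and nn: "0 \<le> k" "0 \<le> l"
  shows "(\<integral>\<^sup>+u\<in>{0<..<k}. (\<integral>\<^sup>+v\<in>{0<..<l}. indicator {..1} (a * inverse u + b * inverse v) \<partial>lborel) \<partial>lborel)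
    = ennreal (hyperbola_area a b k l)"
proof -
  define B where "B u = b + a * b / (u - a)" for u
  have B: "a * inverse u + b * inverse v \<le> 1 \<longleftrightarrow> a < u \<and> B u \<le> v" if "0 < u" "0 < v" for u v
  proof (cases "a < u")
    case True
    have "a * inverse u + b * inverse v \<le> 1 \<longleftrightarrow> a * v + b * u \<le> u * v"
      using that by (simp add: field_simps)
    also have "\<dots> \<longleftrightarrow> B u \<le> v"
      using True by (simp add: B_def field_simps)
    finally show ?thesis using True by simp
  next
    case False
    then have "1 \<le> a * inverse u" using that by (simp add: field_simps)
    moreover have "0 < b * inverse v" using that pos by simp
    ultimately show ?thesis using False by simp
  qed
  have B_gt: "b < B u" if "a < u" for u using that pos by (simp add: B_def)
  have inner: "(\<integral>\<^sup>+v\<in>{0<..<l}. indicator {..1} (a * inverse u + b * inverse v) \<partial>lborel)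
      = (if a < u then ennreal (l - B u) else 0)" if "0 < u" for u
  proof -
    have "(\<integral>\<^sup>+v\<in>{0<..<l}. indicator {..1} (a * inverse u + b * inverse v) \<partial>lborel)
        = (\<integral>\<^sup>+v. indicator (if a < u then {B u..<l} else {}) v \<partial>lborel)"
      using B[OF that] B_gt[of u] pos by (intro nn_integral_cong) (auto simp: indicator_def)
    also have "\<dots> = (if a < u then ennreal (l - B u) else 0)"
      by (cases "B u \<le> l") (simp_all add: ennreal_neg)
    finally show ?thesis .
  qed
  let ?D = "k * l - k * b - l * a"
  have "(\<integral>\<^sup>+u\<in>{0<..<k}. (\<integral>\<^sup>+v\<in>{0<..<l}. indicator {..1} (a * inverse u + b * inverse v) \<partial>lborel) \<partial>lborel)
      = (\<integral>\<^sup>+u. ennreal (l - B u) * indicator {a<..<k} u \<partial>lborel)"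
  proof (intro nn_integral_cong)
    fix u :: real
    show "(\<integral>\<^sup>+v\<in>{0<..<l}. indicator {..1} (a * inverse u + b * inverse v) \<partial>lborel) * indicator {0<..<k} u
        = ennreal (l - B u) * indicator {a<..<k} u"
      using pos by (cases "0 < u") (simp_all only: inner, auto simp: indicator_def)
  qed
  also have "\<dots> = ennreal (hyperbola_area a b k l)"
  proof (cases "?D \<le> 0")
    case True
    have "l - B u \<le> 0" if "a < u" "u < k" for u
    proof -
      have "l * (u - a) \<le> b * u"
      proof (cases "l \<le> b")
        case True
        then show ?thesis using that pos nn mult_mono[of l b "u - a" u] by simp
      next
        case False
        have "(l - b) * u \<le> (l - b) * k" using False that by (intro mult_left_mono) auto
        then show ?thesis using \<open>?D \<le> 0\<close> by (simp add: algebra_simps)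
      qed
      then show ?thesis using that by (simp add: B_def field_simps)
    qed
    then have "(\<integral>\<^sup>+u. ennreal (l - B u) * indicator {a<..<k} u \<partial>lborel) = (\<integral>\<^sup>+u. 0 \<partial>(lborel :: real measure))"
      by (intro nn_integral_cong) (auto simp: ennreal_neg indicator_def)
    also have "\<dots> = ennreal (hyperbola_area a b k l)"
      using True pos by (simp add: hyperbola_area_def psi_nonpos divide_le_0_iff)
    finally show ?thesis .
  next
    case False
    then have D: "0 < ?D" by simp
    have bl: "b < l"
    proof (rule ccontr)
      assume "\<not> b < l"
      then have "k * l \<le> k * b" using nn by (intro mult_left_mono) auto
      then show False using D mult_nonneg_nonneg[OF nn(2) less_imp_le[OF pos(1)]] by linarith
    qed
    define u0 where "u0 = a + a * b / (l - b)"
    have u0: "a < u0" using pos bl by (simp add: u0_def)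
    have u0k: "u0 < k" using D bl by (simp add: u0_def field_simps)
    have sgn: "0 \<le> l - B u \<longleftrightarrow> u0 \<le> u" if "a < u" for u
      using that bl by (simp add: u0_def B_def field_simps)
    have AE: "AE u in lborel. u \<noteq> k" by (rule AE_lborel_singleton)
    have "(\<integral>\<^sup>+u. ennreal (l - B u) * indicator {a<..<k} u \<partial>lborel)
        = (\<integral>\<^sup>+u. ennreal (l - B u) * indicator {u0..k} u \<partial>lborel)"
    proof (intro nn_integral_cong_AE, use AE in eventually_elim)
      case (elim u)
      then show ?case using sgn[of u] u0 by (auto simp: indicator_def ennreal_neg)
    qed
    also have "\<dots> = ennreal (((l - b) * k - a * b * ln (k - a)) - ((l - b) * u0 - a * b * ln (u0 - a)))"
    proof (rule nn_integral_FTC_Icc[where F = "\<lambda>u. (l - b) * u - a * b * ln (u - a)"])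
      show "DERIV (\<lambda>u. (l - b) * u - a * b * ln (u - a)) u :> l - B u" if "u \<in> {u0..k}" for u
        using that u0 by (auto intro!: derivative_eq_intros simp: B_def field_simps)
    qed (use u0 u0k sgn in \<open>auto simp: B_def\<close>)
    also have "\<dots> = ennreal (hyperbola_area a b k l)"
    proof -
      have "1 + ?D / (a * b) = (k - a) / (u0 - a)"
        using pos bl by (simp add: u0_def field_simps)
      then have ln: "ln (1 + ?D / (a * b)) = ln (k - a) - ln (u0 - a)"
        using u0 u0k by (simp add: ln_div)
      have lin: "(l - b) * k - (l - b) * u0 = ?D"
        using bl by (simp add: u0_def field_simps)
      have nn: "0 \<le> ?D / (a * b)" using D pos by simp
      have "hyperbola_area a b k l = a * b * (?D / (a * b)) - a * b * (ln (k - a) - ln (u0 - a))"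
        by (simp only: hyperbola_area_def psi_def max_absorb1[OF nn] ln right_diff_distrib)
      also have "a * b * (?D / (a * b)) = (l - b) * k - (l - b) * u0"
        using pos lin by simp
      finally have "hyperbola_area a b k l
          = (l - b) * k - (l - b) * u0 - a * b * (ln (k - a) - ln (u0 - a))" .
      then show ?thesis by (intro arg_cong[where f = ennreal]) (simp add: right_diff_distrib)
    qed
    finally show ?thesis .
  qed
  finally show ?thesis .
qed

section \<open>Inverse-concave tails as mixtures of Pareto laws\<close>

text \<open>
  A concave function is the integral of any function squeezed between its slopes. The error on an
  interval is at most its length times the drop of \<open>g\<close>, and such a bound halves whenever the interval is bisected, since the drops telescope.
\<close>

lemma has_integral_of_slope_bounds:
  fixes g G :: "real \<Rightarrow> real"
  assumes st: "s \<le> t"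
    and slope: "\<And>u v. s \<le> u \<Longrightarrow> u < v \<Longrightarrow> v \<le> t \<Longrightarrow>
      (v - u) * g v \<le> G v - G u \<and> G v - G u \<le> (v - u) * g u"
  shows "(g has_integral (G t - G s)) {s..t}"
proof -
  have anti: "g v \<le> g u" if "s \<le> u" "u \<le> v" "v \<le> t" for u v
  proof (cases "u = v")
    case False
    then have "(v - u) * g v \<le> (v - u) * g u" using slope[of u v] that by linarith
    then show ?thesis using False that by (simp add: mult_le_cancel_left)
  qed simp
  have int: "g integrable_on {u..v}" if "s \<le> u" "v \<le> t" for u v
  proof -
    have "(\<lambda>x. - g x) integrable_on {u..v}"
      using that by (intro integrable_on_mono_on) (auto simp: mono_on_def intro!: anti)
    then show ?thesis using integrable_neg by fastforce
  qed
  define E where "E u v = integral {u..v} g - (G v - G u)" for u v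
  have E0: "\<bar>E u v\<bar> \<le> (v - u) * (g u - g v)" if "s \<le> u" "u < v" "v \<le> t" for u v
  proof -
    have "integral {u..v} g \<le> integral {u..v} (\<lambda>_. g u)"
      using that by (intro integral_le int) (auto intro: anti)
    moreover have "integral {u..v} (\<lambda>_. g v) \<le> integral {u..v} g"
      using that by (intro integral_le int) (auto intro: anti)
    ultimately show ?thesis
      using slope[OF that] that by (simp add: E_def abs_le_iff right_diff_distrib)
  qed
  have En: "\<bar>E u v\<bar> \<le> (v - u) * (g u - g v) / 2 ^ n" if "s \<le> u" "u < v" "v \<le> t" for u v n
    using that
  proof (induction n arbitrary: u v)
    case 0
    then show ?case using E0 by simp
  next
    case (Suc n)
    define m where "m = (u + v) / 2"
    have m: "u < m" "m < v" "m - u = (v - u) / 2" "v - m = (v - u) / 2"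
      using Suc.prems by (auto simp: m_def field_simps)
    have "integral {u..v} g = integral {u..m} g + integral {m..v} g"
      using m Suc.prems by (intro Henstock_Kurzweil_Integration.integral_combine[symmetric] int) auto
    then have "\<bar>E u v\<bar> \<le> \<bar>E u m\<bar> + \<bar>E m v\<bar>" unfolding E_def by simp
    also have "\<dots> \<le> (m - u) * (g u - g m) / 2 ^ n + (v - m) * (g m - g v) / 2 ^ n"
      using m Suc.prems by (intro add_mono Suc.IH) auto
    also have "\<dots> = (v - u) * (g u - g v) / 2 ^ Suc n"
      unfolding m by (simp add: field_simps)
    finally show ?case .
  qed
  have "E s t = 0"
  proof (cases "s = t")
    case False
    have "(\<lambda>n. (t - s) * (g s - g t) * inverse (2 ^ n)) \<longlonglongrightarrow> (t - s) * (g s - g t) * 0"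
      by (intro tendsto_intros LIMSEQ_inverse_realpow_zero) auto
    then have "(\<lambda>n. (t - s) * (g s - g t) / 2 ^ n) \<longlonglongrightarrow> 0"
      unfolding divide_inverse by simp
    then have "\<bar>E s t\<bar> \<le> 0"
      by (rule LIMSEQ_le_const) (use En[of s t] st False in auto)
    then show ?thesis by simp
  qed (simp add: E_def)
  then show ?thesis using int[of s t] by (simp add: E_def has_integral_iff)
qed

text \<open>
  The right derivative of a concave function: its difference quotients decrease in \<open>h\<close>, so the limit
  for \<open>h \<longlongrightarrow> 0\<close> is a supremum.
\<close>

definition right_slope :: "(real \<Rightarrow> real) \<Rightarrow> real \<Rightarrow> real" where
  "right_slope G u = (SUP h\<in>{0<..}. (G (u + h) - G u) / h)"

lemma right_slope_bounds:
  assumes conc: "concave_on {0<..} G" and uv: "0 < u" "u < v"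
  shows "(v - u) * right_slope G v \<le> G v - G u" and "G v - G u \<le> (v - u) * right_slope G u"
proof -
  have chord: "(G z - G y) / (z - y) \<le> (G y - G x) / (y - x)" if "0 < x" "x < y" "y < z" for x y z
  proof -
    have cv: "convex_on {0<..} (\<lambda>x. - G x)" using conc by (simp add: concave_on_def)
    have "(- G x - - G y) / (x - y) \<le> (- G y - - G z) / (y - z)"
      using convex_on_slope_le[OF cv, of x z y] that by fastforce
    then show ?thesis using that by (simp add: divide_simps split: if_splits) (argo)
  qed
  have "right_slope G v \<le> (G v - G u) / (v - u)"
    unfolding right_slope_def using chord[of u v "v + h" for h] uv
    by (intro cSUP_least) (auto simp: greaterThan_def)
  then show "(v - u) * right_slope G v \<le> G v - G u"
    using uv by (simp add: field_simps)
  have "(G (u + (v - u)) - G u) / (v - u) \<le> right_slope G u"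
    unfolding right_slope_def
  proof (rule cSUP_upper)
    show "bdd_above ((\<lambda>h. (G (u + h) - G u) / h) ` {0<..})"
      using chord[of "u / 2" u "u + h" for h] uv
      by (intro bdd_aboveI[where M = "(G u - G (u / 2)) / (u - u / 2)"]) auto
  qed (use uv in auto)
  then show "G v - G u \<le> (v - u) * right_slope G u"
    using uv by (simp add: field_simps)
qed


lemma right_slope_antimono:
  assumes conc: "concave_on {0<..} G" and uv: "0 < u" "u \<le> v"
  shows "right_slope G v \<le> right_slope G u"
proof (cases "u = v")
  case False
  then have "(v - u) * right_slope G v \<le> (v - u) * right_slope G u"
    using right_slope_bounds[OF conc, of u v] uv by linarith
  then show ?thesis using False uv by (simp add: mult_le_cancel_left)
qed simp

lemma emeasure_slope_density:
  fixes G :: "real \<Rightarrow> real"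
  assumes conc: "concave_on {0<..} G" and g0: "\<And>u. 0 < u \<Longrightarrow> 0 \<le> right_slope G u"
    and lim: "(G \<longlongrightarrow> 0) (at_right 0)" and t: "0 < t"
  defines "N \<equiv> density lborel (\<lambda>u. ennreal (right_slope G u) * indicator {0<..} u)"
  shows "(\<lambda>u. ennreal (right_slope G u) * indicator {0<..} u) \<in> borel_measurable borel"
    and "emeasure N {0<..t} = ennreal (G t)"
proof -
  note bnd = right_slope_bounds[OF conc]
  have "(\<lambda>u. - right_slope G u) \<in> borel_measurable (restrict_space borel {0<..})"
    by (intro borel_measurable_mono_on_fnc) (auto simp: mono_on_def intro!: right_slope_antimono[OF conc])
  then have meas: "right_slope G \<in> borel_measurable (restrict_space borel {0<..})"
    by (simp add: borel_measurable_uminus_eq)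
  then have "(\<lambda>u. ennreal (right_slope G u)) \<in> borel_measurable (restrict_space borel {0<..})"
    by measurable
  then show meas': "(\<lambda>u. ennreal (right_slope G u) * indicator {0<..} u) \<in> borel_measurable borel"
    by (subst (asm) borel_measurable_restrict_space_iff_ennreal) auto
  have sets: "sets N = sets borel" by (simp add: N_def)
  have N_Icc: "emeasure N {s..t} = ennreal (G t - G s)" if "0 < s" "s \<le> t" for s
  proof -
    have "emeasure N {s..t} = (\<integral>\<^sup>+u. ennreal (right_slope G u * indicator {0<..} u * indicator {s..t} u) \<partial>lborel)"
      using meas' unfolding N_def by (subst emeasure_density) (auto intro!: nn_integral_cong simp: indicator_def)
    also have "\<dots> = ennreal (G t - G s)"
    proof (rule nn_integral_has_integral_lborel)
      have "(right_slope G has_integral (G t - G s)) {s..t}"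
        by (rule has_integral_of_slope_bounds) (use bnd that in auto)
      then have "((\<lambda>u. if u \<in> {s..t} then right_slope G u else 0) has_integral (G t - G s)) UNIV"
        by (subst has_integral_restrict_UNIV)
      then show "((\<lambda>u. right_slope G u * indicator {0<..} u * indicator {s..t} u) has_integral (G t - G s)) UNIV"
        by (rule has_integral_eq[rotated]) (use that in \<open>auto simp: indicator_def\<close>)
      have "(\<lambda>u. right_slope G u * indicator {0<..} u) \<in> borel_measurable borel"
        using meas by (subst (asm) borel_measurable_restrict_space_iff) (auto simp: mult.commute)
      then show "(\<lambda>u. right_slope G u * indicator {0<..} u * indicator {s..t} u) \<in> borel_measurable borel"
        by measurable
    qed (use g0 in \<open>auto simp: indicator_def\<close>)
    finally show ?thesis .
  qed
  define s where "s n = t / real (Suc n)" for n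
  have s: "0 < s n" "s n \<le> t" for n using t by (auto simp: s_def field_simps)
  have "(\<lambda>n. emeasure N {s n..t}) \<longlonglongrightarrow> emeasure N (\<Union>n. {s n..t})"
  proof (intro Lim_emeasure_incseq)
    have "s n \<le> s m" if "m \<le> n" for m n using that t unfolding s_def by (intro divide_left_mono) auto
    then show "incseq (\<lambda>n. {s n..t})" by (auto simp: incseq_def intro: order_trans)
  qed (auto simp: sets)
  moreover have "(\<Union>n. {s n..t}) = {0<..t}"
  proof (intro equalityI subsetI)
    fix u assume "u \<in> {0<..t}"
    then obtain n where "t / u < real n" using reals_Archimedean2 by blast
    then have "s n \<le> u" using \<open>u \<in> _\<close> by (simp add: s_def field_simps)
    then show "u \<in> (\<Union>n. {s n..t})" using \<open>u \<in> _\<close> by auto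
  next
    fix u assume "u \<in> (\<Union>n. {s n..t})"
    then obtain n where "s n \<le> u" "u \<le> t" by auto
    then show "u \<in> {0<..t}" using s(1)[of n] by simp
  qed
  moreover have "(\<lambda>n. emeasure N {s n..t}) \<longlonglongrightarrow> ennreal (G t - 0)"
  proof -
    have "(\<lambda>n. t * inverse (real (Suc n))) \<longlonglongrightarrow> t * 0"
      by (intro tendsto_intros LIMSEQ_inverse_real_of_nat)
    then have "s \<longlonglongrightarrow> 0" unfolding s_def by (simp add: divide_inverse)
    then have "filterlim s (at_right 0) sequentially"
      using s by (intro tendsto_imp_filterlim_at_right always_eventually) auto
    then have "(\<lambda>n. G (s n)) \<longlonglongrightarrow> 0" by (rule filterlim_compose[OF lim])
    then have "(\<lambda>n. ennreal (G t - G (s n))) \<longlonglongrightarrow> ennreal (G t - 0)"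
      by (intro tendsto_intros)
    then show ?thesis by (simp only: N_Icc[OF s])
  qed
  ultimately have "emeasure N {0<..t} = ennreal (G t - 0)"
    by (simp only:) (rule LIMSEQ_unique)
  then show "emeasure N {0<..t} = ennreal (G t)" by simp
qed

lemma AE_nonneg_class_H:
  assumes \<mu>: "real_distribution \<mu>" and H: "cdf \<mu> \<in> class_H"
  shows "AE s in \<mu>. 0 \<le> s"
proof -
  interpret \<mu>: real_distribution \<mu> by fact
  have "measure \<mu> {..<0} = 0"
    using H \<mu>.cdf_at_left[of 0] by (auto simp: class_H_def intro: tendsto_unique[rotated])
  then have "emeasure \<mu> {..<0} = 0" by (simp add: \<mu>.emeasure_eq_measure)
  then show ?thesis by (intro AE_I[where N = "{..<0}"]) auto
qed

text \<open>
  If \<open>u\<close> is uniformly distributed on \<open>(0, k)\<close>, then \<open>1 / u\<close> has the Pareto tail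
  \<open>min 1 (1 / (k * x))\<close> at \<open>x > 0\<close>.
  So \<open>\<mu>\<close> is the sum of an atom at \<open>0\<close> and of Pareto laws of tail index \<open>1\<close>, the one with parameter \<open>K y\<close>
  entering with mass \<open>K y\<close>; the mixing parameter \<open>y\<close> ranges over the reals with Lebesgue measure, and
  \<open>K y = 0\<close> contributes nothing. Stating this for integrals makes it directly usable under Fubini's
  theorem.
\<close>

definition Pareto_mixing :: "real measure \<Rightarrow> (real \<Rightarrow> real) \<Rightarrow> bool" where
  "Pareto_mixing \<mu> K \<longleftrightarrow> K \<in> borel_measurable borel \<and> (\<forall>y. 0 \<le> K y) \<and>
    (\<forall>f\<in>borel_measurable borel. integral\<^sup>N \<mu> f =
      emeasure \<mu> {0} * f 0 + (\<integral>\<^sup>+y. (\<integral>\<^sup>+u\<in>{0<..<K y}. f (inverse u) \<partial>lborel) \<partial>lborel))"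

text \<open>
  The tail \<open>G t = 1 - F (1 / t)\<close> is the distribution function of \<open>1 / X\<close> on \<open>(0, \<infinity>)\<close>. As it is concave, it
  has a decreasing density \<open>g\<close>, and the layers \<open>{u. y < g u}\<close> of the region below the graph of \<open>g\<close>
  are intervals \<open>(0, K y)\<close>, up to the right end point. Integrating over that region by vertical lines
  gives the law of \<open>1 / X\<close>, and by horizontal lines the mixture of the layers.
\<close>

lemma Pareto_mixture:
  assumes \<mu>: "real_distribution \<mu>" and H: "cdf \<mu> \<in> class_H"
  obtains K where "Pareto_mixing \<mu> K"
proof -
  interpret \<mu>: real_distribution \<mu> by fact
  define G where "G t = 1 - cdf \<mu> (1 / t)" for t
  define g where "g = right_slope G"
  have conc: "concave_on {0<..} G" using H by (simp add: class_H_def G_def[abs_def])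
  have G01: "0 \<le> G t" "G t \<le> 1" for t
    using \<mu>.cdf_bounded_prob \<mu>.cdf_nonneg by (auto simp: G_def)
  have G_mono: "G s \<le> G t" if "0 < s" "s \<le> t" for s t
    using that unfolding G_def by (intro diff_left_mono \<mu>.cdf_nondecreasing divide_left_mono) auto
  have bnd: "(v - u) * g v \<le> G v - G u" "G v - G u \<le> (v - u) * g u" if "0 < u" "u < v" for u v
    using right_slope_bounds[OF conc that] by (simp_all add: g_def)
  have g0: "0 \<le> g u" if "0 < u" for u
    using bnd(2)[of u "u + 1"] G_mono[of u "u + 1"] that by simp
  have g_anti: "g v \<le> g u" if "0 < u" "u \<le> v" for u v
    using right_slope_antimono[OF conc that] by (simp add: g_def)
  have g_le: "u * g u \<le> 2" if "0 < u" for u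
  proof -
    have "u / 2 * g u \<le> G u - G (u / 2)" using bnd(1)[of "u / 2" u] that by simp
    also have "\<dots> \<le> 1" using G01[of u] G01[of "u / 2"] by simp
    finally show ?thesis by simp
  qed
  have G_lim0: "(G \<longlongrightarrow> 0) (at_right 0)"
  proof -
    have "((\<lambda>t. 1 - cdf \<mu> (inverse t)) \<longlongrightarrow> 1 - 1) (at_right 0)"
      by (intro tendsto_intros filterlim_compose[OF \<mu>.cdf_lim_at_top_prob] filterlim_inverse_at_top_right)
    then show ?thesis by (simp add: G_def[abs_def] inverse_eq_divide)
  qed
  let ?d = "\<lambda>u. ennreal (g u) * indicator {0<..} u"
  define N where "N = density lborel ?d"
  have d_meas [measurable]: "?d \<in> borel_measurable borel"
    using emeasure_slope_density(1)[OF conc _ G_lim0, of 1] g0 by (simp add: g_def)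
  have N_Ioc: "emeasure N {0<..t} = ennreal (G t)" if "0 < t" for t
    unfolding N_def g_def using conc g0 G_lim0 that
    by (intro emeasure_slope_density(2)) (auto simp: g_def)
  have sets_N [simp, measurable_cong]: "sets N = sets borel" by (simp add: N_def)
  have N_single: "emeasure N {t} = 0" for t
    unfolding N_def by (subst emeasure_density) (auto simp: nn_integral_indicator_singleton)
  have AE: "AE u in N. 0 < u"
    using d_meas unfolding N_def by (subst AE_density) (simp, auto intro!: AE_I2 simp: indicator_def)
  have N_Ioi: "emeasure N {0<..} = emeasure \<mu> {0<..}"
  proof -
    have "(\<lambda>n. emeasure N {0<..real (Suc n)}) \<longlonglongrightarrow> emeasure N (\<Union>n. {0<..real (Suc n)})"
      by (intro Lim_emeasure_incseq) (auto simp: incseq_def)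
    moreover have "(\<Union>n. {0<..real (Suc n)}) = {0<..}"
    proof (intro equalityI subsetI)
      fix u :: real assume u: "u \<in> {0<..}"
      obtain n where "u < real n" using reals_Archimedean2 by blast
      with u have "u \<in> {0<..real (Suc n)}" by simp
      then show "u \<in> (\<Union>n. {0<..real (Suc n)})" by blast
    qed auto
    moreover have "(\<lambda>n. emeasure \<mu> {1 / real (Suc n)<..}) \<longlonglongrightarrow> emeasure \<mu> (\<Union>n. {1 / real (Suc n)<..})"
      by (intro Lim_emeasure_incseq) (auto simp: incseq_def field_simps intro: le_less_trans[rotated])
    moreover have "(\<Union>n. {1 / real (Suc n)<..}) = {0<..}"
    proof (intro equalityI subsetI)
      fix u :: real assume "u \<in> {0<..}"
      then obtain n where "inverse (real (Suc n)) < u" using reals_Archimedean by auto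
      then have "u \<in> {1 / real (Suc n)<..}" by (simp add: inverse_eq_divide)
      then show "u \<in> (\<Union>n. {1 / real (Suc n)<..})" by blast
    next
      fix u :: real assume "u \<in> (\<Union>n. {1 / real (Suc n)<..})"
      then obtain n where n: "1 / real (Suc n) < u" by auto
      have "0 < 1 / real (Suc n)" by simp
      with n have "0 < u" by (rule less_trans[rotated])
      then show "u \<in> {0<..}" by simp
    qed
    moreover have "emeasure N {0<..real (Suc n)} = emeasure \<mu> {1 / real (Suc n)<..}" for n
    proof -
      have "measure \<mu> {1 / real (Suc n)<..} = 1 - cdf \<mu> (1 / real (Suc n))"
        using \<mu>.prob_compl[of "{..1 / real (Suc n)}"] by (simp add: cdf_def Compl_eq_Diff_UNIV[symmetric] not_le Compl_atMost)
      then show ?thesis by (simp add: N_Ioc G_def \<mu>.emeasure_eq_measure)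
    qed
    ultimately show ?thesis using LIMSEQ_unique by simp
  qed
  have restrict: "density \<mu> (indicator {0<..}) = distr N borel inverse"
  proof (rule measure_eqI_lessThan)
    have left: "emeasure (density \<mu> (indicator {0<..})) {x<..} = emeasure \<mu> {max x 0<..}" for x
    proof -
      have "{0<..} \<inter> {x<..} = {max x 0<..}" by auto
      then show ?thesis
        by (subst emeasure_density) (simp_all add: indicator_inter_arith[symmetric])
    qed
    show "emeasure (density \<mu> (indicator {0<..})) {x<..} < \<infinity>" for x
      unfolding left by (simp add: \<mu>.emeasure_eq_measure)
    show "emeasure (density \<mu> (indicator {0<..})) {x<..} = emeasure (distr N borel inverse) {x<..}" for x
    proof (cases "0 < x")
      case True
      have "emeasure (distr N borel inverse) {x<..} = emeasure N (inverse -` {x<..} \<inter> space N)"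
        by (subst emeasure_distr) auto
      also have "\<dots> = emeasure N {0<..1 / x}"
      proof (rule emeasure_eq_AE)
        have "AE u in N. u \<noteq> 1 / x"
          using N_single[of "1 / x"] by (intro AE_I[where N = "{1 / x}"]) auto
        with AE show "AE u in N. (u \<in> inverse -` {x<..} \<inter> space N) = (u \<in> {0<..1 / x})"
          by eventually_elim (use True in \<open>auto simp: N_def field_simps\<close>)
      qed (auto simp: measurable_sets_borel)
      also have "\<dots> = emeasure \<mu> {x<..}"
      proof -
        have "measure \<mu> {x<..} = 1 - cdf \<mu> x"
          using \<mu>.prob_compl[of "{..x}"] by (simp add: cdf_def Compl_eq_Diff_UNIV[symmetric] Compl_atMost)
        then show ?thesis using True by (simp add: N_Ioc G_def \<mu>.emeasure_eq_measure)
      qed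
      finally show ?thesis using True left[of x] by simp
    next
      case False
      have "emeasure (distr N borel inverse) {x<..} = emeasure N (inverse -` {x<..} \<inter> space N)"
        by (subst emeasure_distr) auto
      also have "\<dots> = emeasure N {0<..}"
      proof (rule emeasure_eq_AE)
        from AE show "AE u in N. (u \<in> inverse -` {x<..} \<inter> space N) = (u \<in> {0<..})"
          by eventually_elim (use False in \<open>auto simp: N_def intro: le_less_trans[of x 0]\<close>)
      qed (auto simp: measurable_sets_borel)
      finally show ?thesis using False left[of x] N_Ioi by simp
    qed
  qed auto
  \<comment> \<open>The generalised inverse of \<open>g\<close>; the inserted \<open>0\<close> makes it \<open>0\<close> above the supremum of \<open>g\<close>.\<close>
  define K where "K y = (if 0 < y then Sup (insert 0 {u. 0 < u \<and> y < g u}) else 0)" for y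
  have K_bdd: "bdd_above (insert 0 {u. 0 < u \<and> y < g u})" if "0 < y" for y
  proof (rule bdd_aboveI)
    fix u assume "u \<in> insert 0 {u. 0 < u \<and> y < g u}"
    then show "u \<le> 2 / y"
    proof
      assume "u \<in> {u. 0 < u \<and> y < g u}"
      then have "u * y \<le> u * g u" "0 < u" by auto
      with g_le[of u] have "u * y \<le> 2" by linarith
      then show ?thesis using that by (simp add: field_simps)
    qed (use that in simp)
  qed
  have K0: "0 \<le> K y" for y
    using cSup_upper[OF _ K_bdd, of 0 y] by (simp add: K_def)
  have K_less: "u < K y" if "0 < y" "0 < u" "y < g u" "u \<noteq> K y" for u y
    using cSup_upper[OF _ K_bdd, of u y] that by (simp add: K_def)
  have less_K: "0 < y \<and> y < g u" if u: "0 < u" "u < K y" for u y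
  proof -
    have y: "0 < y" using that by (auto simp: K_def split: if_splits)
    then obtain v where "v \<in> insert 0 {u. 0 < u \<and> y < g u}" "u < v"
      using u less_cSup_iff[OF _ K_bdd, of y u] by (auto simp: K_def)
    then have "y < g v" "u < v" using u by auto
    then show ?thesis using g_anti[of u v] u y by simp
  qed
  have K_meas [measurable]: "K \<in> borel_measurable borel"
  proof -
    have "K z \<le> K y" if "0 < y" "y \<le> z" for y z
      using that unfolding K_def by (auto intro!: cSup_subset_mono K_bdd)
    then have "(\<lambda>y. - K y) \<in> borel_measurable (restrict_space borel {0<..})"
      by (intro borel_measurable_mono_on_fnc) (auto simp: mono_on_def)
    then have "K \<in> borel_measurable (restrict_space borel {0<..})"
      by (simp add: borel_measurable_uminus_eq)
    then have "(\<lambda>y. indicator {0<..} y *\<^sub>R K y) \<in> borel_measurable borel"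
      by (subst (asm) borel_measurable_restrict_space_iff) auto
    also have "(\<lambda>y. indicator {0<..} y *\<^sub>R K y) = K"
      by (auto simp: K_def fun_eq_iff indicator_def)
    finally show ?thesis .
  qed
  show thesis
  proof (rule that[of K], unfold Pareto_mixing_def, intro conjI allI ballI K_meas K0)
    fix f :: "real \<Rightarrow> ennreal" assume f [measurable]: "f \<in> borel_measurable borel"
    note nonneg = AE_nonneg_class_H[OF \<mu> H]
    have "integral\<^sup>N \<mu> f = (\<integral>\<^sup>+s. f 0 * indicator {0} s + indicator {0<..} s * f s \<partial>\<mu>)"
      by (intro nn_integral_cong_AE, use nonneg in eventually_elim) (auto simp: indicator_def)
    also have "\<dots> = f 0 * emeasure \<mu> {0} + (\<integral>\<^sup>+s. f s \<partial>density \<mu> (indicator {0<..}))"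
      by (simp add: nn_integral_add nn_integral_cmult_indicator nn_integral_density)
    also have "(\<integral>\<^sup>+s. f s \<partial>density \<mu> (indicator {0<..})) = (\<integral>\<^sup>+u. ?d u * f (inverse u) \<partial>lborel)"
      unfolding restrict by (subst nn_integral_distr) (simp_all add: N_def nn_integral_density)
    also have "\<dots> = (\<integral>\<^sup>+u. (\<integral>\<^sup>+y. of_bool (0 < y \<and> ennreal y < ?d u) * f (inverse u) \<partial>lborel) \<partial>lborel)"
    proof (intro nn_integral_cong)
      fix u :: real
      have "(\<integral>\<^sup>+y. of_bool (0 < y \<and> ennreal y < ?d u) \<partial>lborel)
          = (\<integral>\<^sup>+y. indicator (if 0 < u then {0<..<g u} else {}) y \<partial>lborel)"
        by (intro nn_integral_cong) (auto simp: ennreal_less_iff indicator_def)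
      also have "\<dots> = ?d u"
        using g0[of u] by simp
      finally show "?d u * f (inverse u) = (\<integral>\<^sup>+y. of_bool (0 < y \<and> ennreal y < ?d u) * f (inverse u) \<partial>lborel)"
        by (simp add: nn_integral_multc)
    qed
    also have "\<dots> = (\<integral>\<^sup>+y. (\<integral>\<^sup>+u. of_bool (0 < y \<and> ennreal y < ?d u) * f (inverse u) \<partial>lborel) \<partial>lborel)"
      by (rule lborel_pair.Fubini'[symmetric]) measurable
    also have "\<dots> = (\<integral>\<^sup>+y. (\<integral>\<^sup>+u\<in>{0<..<K y}. f (inverse u) \<partial>lborel) \<partial>lborel)"
    proof (rule nn_integral_cong, rule nn_integral_cong_AE)
      fix y :: real
      \<comment> \<open>Whether \<open>K y\<close> itself belongs to the layer depends on one-sided continuity of \<open>g\<close>.\<close>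
      have "AE u in lborel. u \<noteq> K y" by (rule AE_lborel_singleton)
      then show "AE u in lborel. of_bool (0 < y \<and> ennreal y < ?d u) * f (inverse u) = f (inverse u) * indicator {0<..<K y} u"
      proof eventually_elim
        case (elim u)
        have "0 < y \<and> ennreal y < ?d u \<longleftrightarrow> 0 < u \<and> u < K y"
          using K_less[of y u] less_K[of u y] g0[of u] elim by (auto simp: ennreal_less_iff indicator_def)
        then show ?case by (auto simp: indicator_def)
      qed
    qed
    finally show "integral\<^sup>N \<mu> f =
      emeasure \<mu> {0} * f 0 + (\<integral>\<^sup>+y. (\<integral>\<^sup>+u\<in>{0<..<K y}. f (inverse u) \<partial>lborel) \<partial>lborel)"
      by (simp add: mult.commute)
  qed
qed

section \<open>Weighted sums of independent copies\<close>

lemma hyperbola_area_measurable [measurable]: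
  assumes [measurable]: "k \<in> borel_measurable M" "l \<in> borel_measurable M"
  shows "(\<lambda>x. hyperbola_area a b (k x) (l x)) \<in> borel_measurable M"
  unfolding hyperbola_area_def psi_def by measurable

lemma pred_Ioo_measurable [measurable]:
  fixes h k :: "'a \<Rightarrow> real"
  assumes [measurable]: "h \<in> borel_measurable M" "k \<in> borel_measurable M"
  shows "Measurable.pred M (\<lambda>x. h x \<in> {0<..<k x})"
  unfolding greaterThanLessThan_iff by measurable

text \<open>
  The three terms are the contributions of the atom at \<open>0\<close>, of one variable vanishing, and of none
  vanishing. For \<open>a + b\<close> fixed they are constant, a sum of values at \<open>a\<close> and at \<open>b\<close> of one convex function,
  and a mixture of areas above a hyperbola.
\<close>

lemma cdf_two_point_formula:
  fixes a b :: real and K :: "real \<Rightarrow> real"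
  assumes K: "Pareto_mixing \<mu> K"
    and pos: "0 < a" "0 < b"
  shows "(\<integral>\<^sup>+s. (\<integral>\<^sup>+t. indicator {..1} (a * s + b * t) \<partial>\<mu>) \<partial>\<mu>) =
    emeasure \<mu> {0} * emeasure \<mu> {0}
    + emeasure \<mu> {0} * (\<integral>\<^sup>+y. ennreal (K y - a) + ennreal (K y - b) \<partial>lborel)
    + (\<integral>\<^sup>+y. (\<integral>\<^sup>+z. ennreal (hyperbola_area a b (K y) (K z)) \<partial>lborel) \<partial>lborel)"
proof -
  let ?p = "emeasure \<mu> {0}"
  have [measurable]: "K \<in> borel_measurable borel" and K0: "\<And>y. 0 \<le> K y"
    and mix: "\<And>f. f \<in> borel_measurable borel \<Longrightarrow> integral\<^sup>N \<mu> f =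
      ?p * f 0 + (\<integral>\<^sup>+y. (\<integral>\<^sup>+u\<in>{0<..<K y}. f (inverse u) \<partial>lborel) \<partial>lborel)"
    using K by (auto simp: Pareto_mixing_def)
  have single: "(\<integral>\<^sup>+u. indicator {..1} (c * inverse u) * indicator {0<..<k} u \<partial>lborel) = ennreal (k - c)"
    if "0 < c" for c k :: real
  proof -
    have "(\<integral>\<^sup>+u. indicator {..1} (c * inverse u) * indicator {0<..<k} u \<partial>lborel) = (\<integral>\<^sup>+u. indicator {c..<k} u \<partial>lborel)"
      using that by (intro nn_integral_cong) (auto simp: indicator_def field_simps)
    also have "\<dots> = ennreal (k - c)"
      by (cases "c \<le> k") (simp_all add: ennreal_neg)
    finally show ?thesis .
  qed
  \<comment> \<open>The inner integral at \<open>s\<close>, with the mixture inserted for its variable.\<close>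
  define I where "I s = ?p * indicator {..1} (a * s)
      + (\<integral>\<^sup>+z. (\<integral>\<^sup>+v\<in>{0<..<K z}. indicator {..1} (a * s + b * inverse v) \<partial>lborel) \<partial>lborel)" for s
  have I_meas [measurable]: "I \<in> borel_measurable borel"
    unfolding I_def by measurable
  have "(\<integral>\<^sup>+s. (\<integral>\<^sup>+t. indicator {..1} (a * s + b * t) \<partial>\<mu>) \<partial>\<mu>) = integral\<^sup>N \<mu> I"
    unfolding I_def by (subst mix) (auto simp del: nn_integral_indicator)
  also have "\<dots> = ?p * I 0 + (\<integral>\<^sup>+y. (\<integral>\<^sup>+u\<in>{0<..<K y}. I (inverse u) \<partial>lborel) \<partial>lborel)"
    by (rule mix) measurable
  also have "I 0 = ?p + (\<integral>\<^sup>+z. ennreal (K z - b) \<partial>lborel)"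
    using pos by (simp add: I_def single)
  also have "(\<integral>\<^sup>+y. (\<integral>\<^sup>+u\<in>{0<..<K y}. I (inverse u) \<partial>lborel) \<partial>lborel)
      = (\<integral>\<^sup>+y. ?p * ennreal (K y - a) + (\<integral>\<^sup>+z. ennreal (hyperbola_area a b (K y) (K z)) \<partial>lborel) \<partial>lborel)"
  proof (intro nn_integral_cong)
    fix y
    have "(\<integral>\<^sup>+u\<in>{0<..<K y}. I (inverse u) \<partial>lborel)
      = (\<integral>\<^sup>+u. ?p * (indicator {..1} (a * inverse u) * indicator {0<..<K y} u) \<partial>lborel)
      + (\<integral>\<^sup>+u. (\<integral>\<^sup>+z. (\<integral>\<^sup>+v\<in>{0<..<K z}. indicator {..1} (a * inverse u + b * inverse v) \<partial>lborel) * indicator {0<..<K y} u \<partial>lborel) \<partial>lborel)"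
      unfolding I_def distrib_right
      by (subst nn_integral_add) (simp_all add: nn_integral_multc mult.assoc)
    also have "(\<integral>\<^sup>+u. ?p * (indicator {..1} (a * inverse u) * indicator {0<..<K y} u) \<partial>lborel) = ?p * ennreal (K y - a)"
      by (subst nn_integral_cmult) (simp_all add: single pos)
    also have "(\<integral>\<^sup>+u. (\<integral>\<^sup>+z. (\<integral>\<^sup>+v\<in>{0<..<K z}. indicator {..1} (a * inverse u + b * inverse v) \<partial>lborel) * indicator {0<..<K y} u \<partial>lborel) \<partial>lborel)
      = (\<integral>\<^sup>+z. (\<integral>\<^sup>+u\<in>{0<..<K y}. (\<integral>\<^sup>+v\<in>{0<..<K z}. indicator {..1} (a * inverse u + b * inverse v) \<partial>lborel) \<partial>lborel) \<partial>lborel)"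
      by (rule lborel_pair.Fubini'[symmetric]) measurable
    also have "\<dots> = (\<integral>\<^sup>+z. ennreal (hyperbola_area a b (K y) (K z)) \<partial>lborel)"
      using pos K0 by (simp add: nn_integral_hyperbola)
    finally show "(\<integral>\<^sup>+u\<in>{0<..<K y}. I (inverse u) \<partial>lborel)
      = ?p * ennreal (K y - a) + (\<integral>\<^sup>+z. ennreal (hyperbola_area a b (K y) (K z)) \<partial>lborel)" .
  qed
  also have "\<dots> = ?p * (\<integral>\<^sup>+y. ennreal (K y - a) \<partial>lborel) + (\<integral>\<^sup>+y. (\<integral>\<^sup>+z. ennreal (hyperbola_area a b (K y) (K z)) \<partial>lborel) \<partial>lborel)"
    by (subst nn_integral_add) (simp_all add: nn_integral_cmult)
  finally show ?thesis
    by (simp add: nn_integral_add distrib_left add_ac)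
qed

lemma cdf_two_point_spread_unit:
  assumes \<mu>: "real_distribution \<mu>" and H: "cdf \<mu> \<in> class_H"
    and pos: "0 < a'" "0 < b'" and sum: "a + b = a' + b'"
    and ge: "min a' b' \<le> a" "min a' b' \<le> b"
  shows "(\<integral>\<^sup>+s. (\<integral>\<^sup>+t. indicator {..1} (a * s + b * t) \<partial>\<mu>) \<partial>\<mu>)
    \<le> (\<integral>\<^sup>+s. (\<integral>\<^sup>+t. indicator {..1} (a' * s + b' * t) \<partial>\<mu>) \<partial>\<mu>)"
proof -
  obtain K where K: "Pareto_mixing \<mu> K"
    using Pareto_mixture[OF \<mu> H] by blast
  have [measurable]: "K \<in> borel_measurable borel"
    using K by (simp add: Pareto_mixing_def)
  have pos': "0 < a" "0 < b" using pos ge by (auto simp: min_def split: if_splits)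
  define W where "W a b = (\<integral>\<^sup>+y. (\<integral>\<^sup>+z. ennreal (hyperbola_area a b (K y) (K z)) \<partial>lborel) \<partial>lborel)" for a b
  \<comment> \<open>Both mixing parameters have the same law, so the area may be averaged over their two orders.\<close>
  have W_sym: "W a b + W a b = (\<integral>\<^sup>+y. (\<integral>\<^sup>+z. ennreal (hyperbola_area a b (K y) (K z) + hyperbola_area a b (K z) (K y)) \<partial>lborel) \<partial>lborel)"
    if "0 < a" "0 < b" for a b
  proof -
    have "W a b = (\<integral>\<^sup>+y. (\<integral>\<^sup>+z. ennreal (hyperbola_area a b (K z) (K y)) \<partial>lborel) \<partial>lborel)"
      unfolding W_def by (rule lborel_pair.Fubini') measurable
    then have "W a b + W a b = W a b + (\<integral>\<^sup>+y. (\<integral>\<^sup>+z. ennreal (hyperbola_area a b (K z) (K y)) \<partial>lborel) \<partial>lborel)"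
      by simp
    also have "\<dots> = (\<integral>\<^sup>+y. (\<integral>\<^sup>+z. ennreal (hyperbola_area a b (K y) (K z)) + ennreal (hyperbola_area a b (K z) (K y)) \<partial>lborel) \<partial>lborel)"
      unfolding W_def by (subst nn_integral_add[symmetric]) (simp_all add: nn_integral_add)
    finally show ?thesis using that by (simp add: hyperbola_area_nonneg)
  qed
  have "W a b + W a b \<le> W a' b' + W a' b'"
    unfolding W_sym[OF pos'] W_sym[OF pos]
    by (intro nn_integral_mono ennreal_leI hyperbola_area_spread pos sum ge)
  then have W: "W a b \<le> W a' b'"
    by (metis (no_types) add_strict_mono not_le)
  have lin: "ennreal (k - a) + ennreal (k - b) \<le> ennreal (k - a') + ennreal (k - b')" for k
  proof -
    have e: "ennreal p + ennreal q = ennreal (max 0 p + max 0 q)" for p q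
      by (cases "0 \<le> p"; cases "0 \<le> q") (simp_all add: ennreal_neg max_def)
    show ?thesis unfolding e using sum ge by (intro ennreal_leI) (auto simp: max_def min_def split: if_splits)
  qed
  note formula = cdf_two_point_formula[OF K]
  show ?thesis
    unfolding formula[OF pos'] formula[OF pos]
    by (intro add_mono[OF add_mono[OF order_refl] W[unfolded W_def]] mult_left_mono nn_integral_mono lin) simp
qed

text \<open>
  A positive level scales to \<open>1\<close>. At any other level the event is, up to null sets, either empty or that
  both variables vanish, whatever the positive weights are.
\<close>

lemma cdf_two_point_spread:
  assumes \<mu>: "real_distribution \<mu>" and H: "cdf \<mu> \<in> class_H"
    and pos: "0 < a'" "0 < b'" and sum: "a + b = a' + b'"
    and ge: "min a' b' \<le> a" "min a' b' \<le> b"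
  shows "(\<integral>\<^sup>+s. (\<integral>\<^sup>+t. indicator {..x} (a * s + b * t) \<partial>\<mu>) \<partial>\<mu>)
    \<le> (\<integral>\<^sup>+s. (\<integral>\<^sup>+t. indicator {..x} (a' * s + b' * t) \<partial>\<mu>) \<partial>\<mu>)"
proof (cases "0 < x")
  case True
  have scale: "indicator {..x} (p * s + q * t) = (indicator {..1} (p / x * s + q / x * t) :: ennreal)" for p q s t
    using True by (auto simp: indicator_def divide_simps)
  have "min (a' / x) (b' / x) = min a' b' / x"
    using True by (auto simp: min_def divide_le_cancel)
  then show ?thesis
    unfolding scale using True pos sum ge
    by (intro cdf_two_point_spread_unit[OF \<mu> H]) (auto simp: add_divide_distrib[symmetric] divide_right_mono)
next
  case False
  note nn = AE_nonneg_class_H[OF \<mu> H]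
  have pos': "0 < a" "0 < b" using pos ge by (auto simp: min_def split: if_splits)
  have "(indicator {..x} (a * s + b * t) :: ennreal) \<le> indicator {..x} (a' * s + b' * t)" if "0 \<le> s" "0 \<le> t" for s t
  proof (cases "s = 0 \<and> t = 0")
    case False
    then have "0 < a * s + b * t"
      using that pos' by (metis add_nonneg_pos add_pos_nonneg less_eq_real_def mult_nonneg_nonneg mult_pos_pos)
    then show ?thesis using \<open>\<not> 0 < x\<close> by simp
  qed simp
  then show ?thesis
    by (intro nn_integral_mono_AE, use nn in eventually_elim)
       (intro nn_integral_mono_AE, use nn in eventually_elim, auto)
qed

text \<open>
  Conditionally on the variables whose weights a transfer does not change, the level is shifted and
  only the case of two variables is left. The shifted level may be negative.
\<close>

lemma cdf_weighted_sum_Schur: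
  assumes \<mu>: "real_distribution \<mu>" and H: "cdf \<mu> \<in> class_H"
    and pos: "\<And>k. k < n \<Longrightarrow> 0 < p k" "\<And>k. k < n \<Longrightarrow> 0 < q k"
    and maj: "majorized n p q"
  shows "emeasure (\<Pi>\<^sub>M k\<in>{..<n}. \<mu>) {w \<in> space (\<Pi>\<^sub>M k\<in>{..<n}. \<mu>). (\<Sum>k<n. p k * w k) \<le> x}
    \<le> emeasure (\<Pi>\<^sub>M k\<in>{..<n}. \<mu>) {w \<in> space (\<Pi>\<^sub>M k\<in>{..<n}. \<mu>). (\<Sum>k<n. q k * w k) \<le> x}"
  (is "?\<Phi> p \<le> ?\<Phi> q")
proof (rule Schur_criterion[where \<Phi> = ?\<Phi> and n = n])
  show "?\<Phi> p = ?\<Phi> q" if "\<And>k. k < n \<Longrightarrow> p k = q k" for p q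
    using that by simp
next
  fix q :: "nat \<Rightarrow> real" and i j s t
  assume ij: "i < n" "j < n" "i \<noteq> j" and q: "0 < q i" "0 < q j" and s: "s + t = q i + q j"
    and ge: "min (q i) (q j) \<le> s" "min (q i) (q j) \<le> t"
  interpret \<mu>: real_distribution \<mu> by fact
  interpret product_sigma_finite "\<lambda>_. \<mu>" by standard
  define J where "J = {..<n} - {i, j}"
  have n: "{..<n} = insert i (insert j J)" and J: "finite J" "i \<notin> insert j J" "j \<notin> J"
    using ij by (auto simp: J_def)
  have expand: "?\<Phi> r = (\<integral>\<^sup>+w. (\<integral>\<^sup>+v. (\<integral>\<^sup>+u. indicator {..x - (\<Sum>k\<in>J. r k * w k)} (r j * v + r i * u) \<partial>\<mu>) \<partial>\<mu>)
      \<partial>(\<Pi>\<^sub>M k\<in>J. \<mu>))" for r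
  proof -
    let ?f = "\<lambda>w. indicator {..x} (\<Sum>k\<in>insert i (insert j J). r k * w k) :: ennreal"
    have [measurable]: "?f \<in> borel_measurable (\<Pi>\<^sub>M k\<in>insert i (insert j J). \<mu>)"
      by measurable
    have "?\<Phi> r = integral\<^sup>N (\<Pi>\<^sub>M k\<in>insert i (insert j J). \<mu>) ?f"
      unfolding n
      by (subst nn_integral_indicator[symmetric], measurable)
         (intro nn_integral_cong, simp add: indicator_def)
    also have "\<dots> = (\<integral>\<^sup>+w. (\<integral>\<^sup>+u. ?f (w(i := u)) \<partial>\<mu>) \<partial>(\<Pi>\<^sub>M k\<in>insert j J. \<mu>))"
      using J by (intro product_nn_integral_insert) auto
    also have "\<dots> = (\<integral>\<^sup>+w. (\<integral>\<^sup>+v. (\<integral>\<^sup>+u. ?f (w(j := v, i := u)) \<partial>\<mu>) \<partial>\<mu>) \<partial>(\<Pi>\<^sub>M k\<in>J. \<mu>))"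
      using J by (intro product_nn_integral_insert) (auto, measurable)
    also have "\<dots> = (\<integral>\<^sup>+w. (\<integral>\<^sup>+v. (\<integral>\<^sup>+u. indicator {..x - (\<Sum>k\<in>J. r k * w k)} (r j * v + r i * u) \<partial>\<mu>) \<partial>\<mu>)
      \<partial>(\<Pi>\<^sub>M k\<in>J. \<mu>))"
    proof (intro nn_integral_cong)
      fix w v u
      have "(\<Sum>k\<in>J. r k * (w(j := v, i := u)) k) = (\<Sum>k\<in>J. r k * w k)"
        using J by (intro sum.cong) auto
      then show "?f (w(j := v, i := u)) = indicator {..x - (\<Sum>k\<in>J. r k * w k)} (r j * v + r i * u)"
        using J ij by (simp add: indicator_def algebra_simps)
    qed
    finally show ?thesis .
  qed
  have rest: "(\<Sum>k\<in>J. (q(i := s, j := t)) k * w k) = (\<Sum>k\<in>J. q k * w k)" for w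
    by (intro sum.cong) (auto simp: J_def)
  show "?\<Phi> (q(i := s, j := t)) \<le> ?\<Phi> q"
    unfolding expand rest using ij q s ge
    by (intro nn_integral_mono cdf_two_point_spread[OF \<mu> H]) (auto simp: min.commute)
qed (use pos maj in auto)

section \<open>Comparison of the truncated sums\<close>

theorem proposition4p4:
  fixes n :: nat
    and \<theta> \<eta> :: "nat \<Rightarrow> real"
    and b c x :: real
    and F :: "real \<Rightarrow> real"
    and M :: "'a measure"
    and X Y :: "nat \<Rightarrow> 'a \<Rightarrow> real"
  assumes "\<theta> \<in> open_simplex n" and "\<eta> \<in> open_simplex n"
    and "strictly_majorized n \<theta> \<eta>"
    and "b = 1 / Min (\<eta> ` {..<n})"
    and "prob_space M"
    and "prob_space.indep_vars M (\<lambda>_. borel) X {..<n}"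
    and "F \<in> class_H"
    and "\<And>i. i < n \<Longrightarrow> cdf (distr M borel (X i)) = F"
    and "c \<in> {b<..}"
    and "\<And>i \<omega>. i < n \<Longrightarrow> \<omega> \<in> space M \<Longrightarrow> Y i \<omega> = min (X i \<omega>) c"
    and "x \<in> {0..<c / b}"
  shows "\<P>(\<omega> in M. (\<Sum>i<n. \<eta> i * Y i \<omega>) > x) \<le> \<P>(\<omega> in M. (\<Sum>i<n. \<theta> i * Y i \<omega>) > x)"
proof -
  interpret M: prob_space M by fact
  note \<theta> = assms(1) and \<eta> = assms(2)
  define m where "m = Min (\<eta> ` {..<n})"
  have n: "0 < n" using \<theta> by (cases "n = 0") (auto simp: open_simplex_def)
  have pos: "0 < \<theta> k" "0 < \<eta> k" if "k < n" for k
    using \<theta> \<eta> that by (auto simp: open_simplex_def)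
  have maj: "majorized n \<theta> \<eta>" using assms(3) by (simp add: strictly_majorized_def)
  have m_pos: "0 < m" using n pos unfolding m_def by (subst Min_gr_iff) auto
  \<comment> \<open>The first partial sums in the majorization compare the minima, so \<open>m\<close> also bounds the weights \<open>\<theta>\<close>
    from below.\<close>
  have m_le: "m \<le> \<theta> k" if "k < n" for k
  proof -
    have "incr_rearr n \<eta> 0 \<in> set (sort (map \<eta> [0..<n]))"
      unfolding incr_rearr_def using n by (intro nth_mem) simp
    then have "m \<le> incr_rearr n \<eta> 0"
      unfolding m_def by (intro Min_le) auto
    also have "\<dots> \<le> incr_rearr n \<theta> 0"
      using assms(3) by (auto simp: strictly_majorized_def majorized_def dest!: bspec[of _ _ 1])
    also have "\<dots> \<le> \<theta> k"
    proof -
      have "\<theta> k \<in> set (sort (map \<theta> [0..<n]))" using that by auto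
      then obtain l where "l < n" "sort (map \<theta> [0..<n]) ! l = \<theta> k"
        by (metis diff_zero in_set_conv_nth length_sort length_map length_upt)
      then show ?thesis
        unfolding incr_rearr_def using sorted_nth_mono[of "sort (map \<theta> [0..<n])" 0 l] by simp
    qed
    finally show ?thesis .
  qed
  have c: "0 < c" using assms(4,9) m_pos by (auto simp: m_def intro: less_trans[rotated])
  have x: "x < c * m" using assms(4,11) by (simp add: m_def)
  have X [measurable]: "X i \<in> borel_measurable M" if "i < n" for i
    using assms(6) that by (auto simp: M.indep_vars_def)
  define \<mu> where "\<mu> = distr M borel (X 0)"
  have distr_X: "distr M borel (X i) = \<mu>" if "i < n" for i
    unfolding \<mu>_def using n that X assms(8)
    by (intro cdf_unique M.real_distribution_distr) auto
  have \<mu>: "real_distribution \<mu>" unfolding \<mu>_def using n X by (intro M.real_distribution_distr) auto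
  have H: "cdf \<mu> \<in> class_H" using assms(7,8) n by (simp add: \<mu>_def)
  let ?P = "\<Pi>\<^sub>M k\<in>{..<n}. \<mu>"
  have PiM: "distr M (\<Pi>\<^sub>M k\<in>{..<n}. borel) (\<lambda>\<omega>. \<lambda>k\<in>{..<n}. X k \<omega>) = ?P"
  proof -
    have "distr M (\<Pi>\<^sub>M k\<in>{..<n}. borel) (\<lambda>\<omega>. \<lambda>k\<in>{..<n}. X k \<omega>) = (\<Pi>\<^sub>M k\<in>{..<n}. distr M borel (X k))"
      using assms(6) n X by (subst (asm) M.indep_vars_iff_distr_eq_PiM') auto
    also have "\<dots> = ?P" by (intro PiM_cong) (auto simp: distr_X)
    finally show ?thesis .
  qed
  have law: "emeasure ?P {w \<in> space ?P. (\<Sum>k<n. r k * w k) \<le> x}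
      = emeasure M {\<omega> \<in> space M. (\<Sum>k<n. r k * X k \<omega>) \<le> x}" for r
  proof -
    let ?B = "\<Pi>\<^sub>M k\<in>{..<n}. borel :: real measure"
    have "{w \<in> space ?B. (\<Sum>k<n. r k * w k) \<le> x} \<in> sets ?B" by measurable
    moreover have "(\<lambda>\<omega>. \<lambda>k\<in>{..<n}. X k \<omega>) \<in> M \<rightarrow>\<^sub>M ?B"
      using X by (intro measurable_restrict) auto
    ultimately show ?thesis
      unfolding PiM[symmetric] space_distr
      by (subst emeasure_distr) (auto intro!: arg_cong[where f = "emeasure M"] simp: space_PiM)
  qed
  have nonneg: "AE \<omega> in M. \<forall>i<n. 0 \<le> X i \<omega>"
  proof -
    have "AE \<omega> in M. 0 \<le> X i \<omega>" if "i < n" for i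
      using AE_nonneg_class_H[OF \<mu> H] X[OF that] unfolding distr_X[OF that, symmetric]
      by (subst (asm) AE_distr_iff) auto
    then have "AE \<omega> in M. \<forall>i\<in>{..<n}. 0 \<le> X i \<omega>" by (intro AE_finite_allI) auto
    then show ?thesis by (simp add: Ball_def)
  qed
  let ?Y = "\<lambda>r. {\<omega> \<in> space M. (\<Sum>k<n. r k * min (X k \<omega>) c) \<le> x}"
  have Y_sets: "?Y r \<in> M.events" for r by measurable
  have "emeasure M (?Y \<theta>) \<le> emeasure M {\<omega> \<in> space M. (\<Sum>k<n. \<theta> k * X k \<omega>) \<le> x}"
  proof (rule emeasure_mono_AE)
    show "AE \<omega> in M. \<omega> \<in> ?Y \<theta> \<longrightarrow> \<omega> \<in> {\<omega> \<in> space M. (\<Sum>k<n. \<theta> k * X k \<omega>) \<le> x}"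
      using nonneg
    proof eventually_elim
      case (elim \<omega>)
      show ?case
      proof
        assume \<omega>: "\<omega> \<in> ?Y \<theta>"
        \<comment> \<open>A single truncated variable would contribute at least \<open>c * m > x\<close> to the sum.\<close>
        have "min (X k \<omega>) c = X k \<omega>" if k: "k < n" for k
        proof (rule ccontr)
          assume "min (X k \<omega>) c \<noteq> X k \<omega>"
          then have "c * m \<le> \<theta> k * min (X k \<omega>) c"
            using m_le[OF k] c by (simp add: min_def mult.commute split: if_splits)
          also have "\<dots> \<le> (\<Sum>k<n. \<theta> k * min (X k \<omega>) c)"
            using k pos elim c by (intro member_le_sum) (auto simp: less_imp_le)
          finally show False using \<omega> x by simp
        qed
        then have "(\<Sum>k<n. \<theta> k * min (X k \<omega>) c) = (\<Sum>k<n. \<theta> k * X k \<omega>)"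
          by (intro sum.cong) auto
        then show "\<omega> \<in> {\<omega> \<in> space M. (\<Sum>k<n. \<theta> k * X k \<omega>) \<le> x}" using \<omega> by simp
      qed
    qed
  qed measurable
  also have "\<dots> \<le> emeasure M {\<omega> \<in> space M. (\<Sum>k<n. \<eta> k * X k \<omega>) \<le> x}"
    unfolding law[symmetric] by (rule cdf_weighted_sum_Schur[OF \<mu> H _ _ maj]) (rule pos, assumption)+
  also have "\<dots> \<le> emeasure M (?Y \<eta>)"
  proof (rule emeasure_mono[OF _ Y_sets], safe)
    fix \<omega> assume "(\<Sum>k<n. \<eta> k * X k \<omega>) \<le> x"
    moreover have "(\<Sum>k<n. \<eta> k * min (X k \<omega>) c) \<le> (\<Sum>k<n. \<eta> k * X k \<omega>)"
      using pos by (intro sum_mono mult_left_mono) (auto simp: less_imp_le)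
    ultimately show "(\<Sum>k<n. \<eta> k * min (X k \<omega>) c) \<le> x" by simp
  qed
  finally have le: "M.prob (?Y \<theta>) \<le> M.prob (?Y \<eta>)"
    by (simp add: M.emeasure_eq_measure)
  have compl: "\<P>(\<omega> in M. (\<Sum>i<n. r i * Y i \<omega>) > x) = 1 - M.prob (?Y r)" for r
  proof -
    have "(\<Sum>i<n. r i * Y i \<omega>) = (\<Sum>i<n. r i * min (X i \<omega>) c)" if "\<omega> \<in> space M" for \<omega>
      using assms(10) that by (intro sum.cong) auto
    then have "{\<omega> \<in> space M. (\<Sum>i<n. r i * Y i \<omega>) > x} = space M - ?Y r"
      by (auto simp: not_le)
    then show ?thesis using M.prob_compl[OF Y_sets[of r]] by simp
  qed
  show ?thesis unfolding compl using le by simp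
qed

end
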